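(* For all integers $k \ge 3$ and $l \ge 2$, $$E(d(l,k)) < (k-1)^{l-1/2} \left( 2 + \frac{0.5 + \sqrt{2} + \sqrt{3} + \sqrt{5}}{k-1} \right),$$ $$E(d(l,k)) > (k-1)^{l-1/2} \left( 2 + \frac{2 \sqrt{2}}{k-1} \right).$$
   Context: For a finite simple graph $G$ with adjacency matrix $A(G)$ having eigenvalues $\lambda_1,\dots,\lambda_n$ (with multiplicity), the energy is $E(G)=\sum_{j=1}^n|\lambda_j|$. For integers $l\ge 1$ and $k\ge 2$, the dendrimer $d(l,k)$ is the rooted tree with $l+1$ levels numbered $0,\dots,l$ (level $0$ consists of the root, level $l$ consists of the leaves) in which every vertex in levels $0,\dots,l-1$ (the internal vertices) has degree $k$; i.e. the root has $k$ children, every vertex in levels $1,\dots,l-1$ has $k-1$ children, and vertices in level $l$ have no children. *)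

theory Defs
  imports
    Complex_Main
    "Jordan_Normal_Form.Spectral_Radius"
    "Graph_Theory.Graph_Theory"
begin

text \<open>
  A finite simple graph is a \<^locale>\<open>pair_graph\<close>: every undirected edge is
  represented by the two arcs joining its end points.
\<close>

definition adjacency_matrix :: "'a pair_pre_digraph \<Rightarrow> 'a list \<Rightarrow> complex mat" where
  "adjacency_matrix G vs =
     mat (length vs) (length vs) (\<lambda>(i, j). if (vs ! i, vs ! j) \<in> parcs G then 1 else 0)"

text \<open>
  The eigenvalues are taken over the complex numbers, each weighted by its algebraic
  multiplicity, so that no eigenvalue can be lost.
\<close>

definition matrix_energy :: "complex mat \<Rightarrow> real" where
  "matrix_energy A = (\<Sum>x\<in>spectrum A. real (order x (char_poly A)) * cmod x)"

text \<open>
  The numbering of the vertices is irrelevant, see \<open>graph_energy_eq\<close> below.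
\<close>

definition graph_energy :: "'a pair_pre_digraph \<Rightarrow> real" where
  "graph_energy G =
     matrix_energy (adjacency_matrix G (SOME vs. distinct vs \<and> set vs = pverts G))"

text \<open>
  A vertex of the dendrimer is the list of choices of a child made on the way down from
  the root \<open>[]\<close>; its level is the length of the list.
\<close>

definition dendrimer_verts :: "nat \<Rightarrow> nat \<Rightarrow> nat list set" where
  "dendrimer_verts l k =
     {xs. length xs \<le> l \<and> (\<forall>i<length xs. xs ! i < (if i = 0 then k else k - 1))}"

definition dendrimer :: "nat \<Rightarrow> nat \<Rightarrow> nat list pair_pre_digraph" where
  "dendrimer l k =
     \<lparr> pverts = dendrimer_verts l k,
       parcs = {(u, v). u \<in> dendrimer_verts l k \<and> v \<in> dendrimer_verts l k \<and>
                        (\<exists>c. v = u @ [c] \<or> u = v @ [c])} \<rparr>"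


lemma adjacency_matrix_carrier:
  "adjacency_matrix G vs \<in> carrier_mat (length vs) (length vs)"
  by (simp add: adjacency_matrix_def)

lemma spectrum_similar:
  fixes A B :: "complex mat"
  assumes "similar_mat A B"
  shows "spectrum A = spectrum B"
proof -
  from similar_matD[OF assms] obtain n P Q where
    A: "A \<in> carrier_mat n n" and B: "B \<in> carrier_mat n n" by blast
  show ?thesis
    unfolding spectrum_def
    using eigenvalue_root_char_poly[OF A] eigenvalue_root_char_poly[OF B]
      char_poly_similar[OF assms] by auto
qed

lemma matrix_energy_similar:
  assumes "similar_mat A B"
  shows "matrix_energy A = matrix_energy B"
  using spectrum_similar[OF assms] char_poly_similar[OF assms]
  by (simp add: matrix_energy_def)

lemma adjacency_matrix_similar:
  assumes vs: "distinct vs" and ws: "distinct ws" and eq: "set vs = set ws"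
  shows "similar_mat (adjacency_matrix G vs) (adjacency_matrix G ws)"
proof -
  define n where "n = length vs"
  have n: "length vs = n" "length ws = n"
    using distinct_card[OF vs] distinct_card[OF ws] eq by (auto simp: n_def)
  define P :: "complex mat" where "P = mat n n (\<lambda>(i, j). if vs ! i = ws ! j then 1 else 0)"
  define Q :: "complex mat" where "Q = mat n n (\<lambda>(i, j). if ws ! i = vs ! j then 1 else 0)"
  have inv: "\<exists>j<n. ws ! j = vs ! i" if "i < n" for i
    using that eq n by (metis in_set_conv_nth)
  have inv': "\<exists>j<n. vs ! j = ws ! i" if "i < n" for i
    using that eq n by (metis in_set_conv_nth)
  have sel: "(\<Sum>j\<in>{0..<n}. (if xs ! i = ys ! j then 1 else 0) * f j) = f j0"
    if "j0 < n" "ys ! j0 = xs ! i" "distinct ys" "length ys = n"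
    for i j0 xs ys and f :: "nat \<Rightarrow> complex"
  proof -
    have "(\<Sum>j\<in>{0..<n}. (if xs ! i = ys ! j then 1 else 0) * f j)
        = (\<Sum>j\<in>{0..<n}. if j = j0 then f j else 0)"
      using that by (intro sum.cong) (auto simp: nth_eq_iff_index_eq)
    then show ?thesis using that by simp
  qed
  have prod: "mat n n (\<lambda>(i, j). if xs ! i = ys ! j then 1 else 0) *
              mat n n (\<lambda>(i, j). if ys ! i = xs ! j then 1 else 0) = (1\<^sub>m n :: complex mat)"
    if "distinct xs" "distinct ys" "length xs = n" "length ys = n"
       and ex: "\<And>i. i < n \<Longrightarrow> \<exists>j<n. ys ! j = xs ! i" for xs ys :: "'a list"
  proof (rule eq_matI)
    fix i j assume "i < dim_row (1\<^sub>m n :: complex mat)" "j < dim_col (1\<^sub>m n :: complex mat)"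
    then have ij: "i < n" "j < n" by auto
    obtain j0 where j0: "j0 < n" "ys ! j0 = xs ! i" using ex[OF ij(1)] by blast
    show "(mat n n (\<lambda>(i, j). if xs ! i = ys ! j then 1 else 0) *
           mat n n (\<lambda>(i, j). if ys ! i = xs ! j then 1 else 0)) $$ (i, j)
          = (1\<^sub>m n :: complex mat) $$ (i, j)"
      using ij that(1,3) j0(2)
        sel[OF j0 that(2,4), of "\<lambda>m. if ys ! m = xs ! j then 1 else 0"]
      by (simp add: scalar_prod_def nth_eq_iff_index_eq)
  qed auto
  have PQ: "P * Q = 1\<^sub>m n" and QP: "Q * P = 1\<^sub>m n"
    unfolding P_def Q_def using prod vs ws n inv inv' by blast+
  let ?A = "adjacency_matrix G vs" and ?B = "adjacency_matrix G ws"
  have A: "?A \<in> carrier_mat n n" and B: "?B \<in> carrier_mat n n"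
    using adjacency_matrix_carrier[of G vs] adjacency_matrix_carrier[of G ws] n by auto
  have P: "P \<in> carrier_mat n n" and Q: "Q \<in> carrier_mat n n" by (auto simp: P_def Q_def)
  have PB: "P * ?B = ?A * P"
  proof (rule eq_matI)
    fix i j assume "i < dim_row (?A * P)" "j < dim_col (?A * P)"
    then have ij: "i < n" "j < n" using A P by auto
    obtain a where a: "a < n" "ws ! a = vs ! i" using inv[OF ij(1)] by blast
    obtain b where b: "b < n" "vs ! b = ws ! j" using inv'[OF ij(2)] by blast
    have "(P * ?B) $$ (i, j) = (if (vs ! i, ws ! j) \<in> parcs G then 1 else 0)"
      using ij n a sel[OF a ws n(2), of "\<lambda>m. if (ws ! m, ws ! j) \<in> parcs G then 1 else 0"]
      by (simp add: P_def adjacency_matrix_def scalar_prod_def)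
    moreover have "(?A * P) $$ (i, j) = (if (vs ! i, ws ! j) \<in> parcs G then 1 else 0)"
    proof -
      have "(?A * P) $$ (i, j) = (\<Sum>m\<in>{0..<n}. (if (vs ! i, vs ! m) \<in> parcs G then 1 else 0) *
              (if vs ! m = ws ! j then 1 else 0))"
        using ij n by (simp add: P_def adjacency_matrix_def scalar_prod_def)
      also have "\<dots> = (\<Sum>m\<in>{0..<n}. (if ws ! j = vs ! m then 1 else 0) *
              (if (vs ! i, vs ! m) \<in> parcs G then 1 else 0))"
        by (rule sum.cong) auto
      also have "\<dots> = (if (vs ! i, ws ! j) \<in> parcs G then 1 else 0)"
        using sel[OF b vs n(1), of "\<lambda>m. if (vs ! i, vs ! m) \<in> parcs G then 1 else 0"] b(2)
        by simp
      finally show ?thesis .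
    qed
    ultimately show "(P * ?B) $$ (i, j) = (?A * P) $$ (i, j)" by simp
  qed (use A B P in auto)
  have "P * ?B * Q = ?A * (P * Q)"
    using PB A P Q by (simp add: assoc_mult_mat)
  then have "?A = P * ?B * Q" using PQ A by simp
  then show ?thesis
    using A B P Q PQ QP by (intro similar_matI[of _ _ P Q n]) auto
qed

lemma graph_energy_eq:
  assumes "distinct vs" "set vs = pverts G"
  shows "graph_energy G = matrix_energy (adjacency_matrix G vs)"
proof -
  have "distinct (SOME vs. distinct vs \<and> set vs = pverts G) \<and>
        set (SOME vs. distinct vs \<and> set vs = pverts G) = pverts G"
    using assms by (rule_tac someI[of _ vs]) auto
  then show ?thesis
    unfolding graph_energy_def
    using assms by (intro matrix_energy_similar adjacency_matrix_similar) auto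
qed

lemma finite_dendrimer_verts: "finite (dendrimer_verts l k)"
proof (rule finite_subset)
  show "dendrimer_verts l k \<subseteq> {xs. set xs \<subseteq> {..<k} \<and> length xs \<le> l}"
  proof
    fix xs assume xs: "xs \<in> dendrimer_verts l k"
    have "x < k" if "x \<in> set xs" for x
    proof -
      obtain i where "i < length xs" "x = xs ! i" using \<open>x \<in> set xs\<close> by (metis in_set_conv_nth)
      then have "x < (if i = 0 then k else k - 1)" using xs by (simp add: dendrimer_verts_def)
      then show ?thesis by (simp split: if_splits)
    qed
    then show "xs \<in> {xs. set xs \<subseteq> {..<k} \<and> length xs \<le> l}"
      using xs by (auto simp: dendrimer_verts_def)
  qed
  show "finite {xs. set xs \<subseteq> {..<k} \<and> length xs \<le> l}"
    by (rule finite_lists_length_le) simp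
qed

lemma pair_graph_dendrimer: "pair_graph (dendrimer l k)"
proof
  show "finite (parcs (dendrimer l k))"
    by (rule finite_subset[of _ "dendrimer_verts l k \<times> dendrimer_verts l k"])
       (auto simp: dendrimer_def finite_dendrimer_verts)
qed (auto simp: dendrimer_def finite_dendrimer_verts symmetric_def sym_def)

lemma dendrimer_verts_snoc:
  "xs @ [c] \<in> dendrimer_verts l k \<longleftrightarrow>
     xs \<in> dendrimer_verts l k \<and> length xs < l \<and> c < (if xs = [] then k else k - 1)"
  (is "?L \<longleftrightarrow> ?R")
proof -
  have "?L \<longleftrightarrow> length xs < l \<and>
          (\<forall>i<Suc (length xs). (xs @ [c]) ! i < (if i = 0 then k else k - 1))"
    by (simp add: dendrimer_verts_def Suc_le_eq)
  also have "\<dots> \<longleftrightarrow> ?R"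
    unfolding All_less_Suc
    by (simp add: dendrimer_verts_def nth_append less_imp_le conj_ac cong: conj_cong)
  finally show ?thesis .
qed

lemma dendrimer_children:
  assumes "xs \<in> dendrimer_verts l k"
  shows "{v \<in> dendrimer_verts l k. \<exists>c. v = xs @ [c]} =
         (\<lambda>c. xs @ [c]) ` {..<if length xs = l then 0 else if xs = [] then k else k - 1}"
    (is "?L = ?R")
proof (rule Set.set_eqI)
  fix v
  have le: "length xs \<le> l" using assms by (simp add: dendrimer_verts_def)
  have "v \<in> ?L \<longleftrightarrow> (\<exists>c. v = xs @ [c] \<and> xs @ [c] \<in> dendrimer_verts l k)" by blast
  also have "\<dots> \<longleftrightarrow> v \<in> ?R"
    unfolding dendrimer_verts_snoc using assms le by (simp add: image_iff) auto
  finally show "v \<in> ?L \<longleftrightarrow> v \<in> ?R" .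
qed

lemma dendrimer_degree_internal:
  assumes xs: "xs \<in> dendrimer_verts l k" and l: "length xs < l" and k: "k \<ge> 1"
  shows "out_degree (dendrimer l k) xs = k"
proof -
  let ?V = "dendrimer_verts l k"
  let ?m = "if xs = [] then k else k - 1"
  let ?C = "(\<lambda>c. xs @ [c]) ` {..<?m}"
  let ?U = "if xs = [] then {} else {butlast xs}"
  have "out_arcs (dendrimer l k) xs =
          Pair xs ` ({v \<in> ?V. \<exists>c. v = xs @ [c]} \<union> {v \<in> ?V. \<exists>c. xs = v @ [c]})"
    using xs by (auto simp: out_arcs_def dendrimer_def)
  moreover have "{v \<in> ?V. \<exists>c. v = xs @ [c]} = ?C"
    using dendrimer_children[OF xs] l by simp
  moreover have "{v \<in> ?V. \<exists>c. xs = v @ [c]} = ?U"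
    using xs by (cases xs rule: rev_cases) (auto simp: dendrimer_verts_snoc)
  ultimately have "out_degree (dendrimer l k) xs = card (?C \<union> ?U)"
    by (simp add: out_degree_def card_image inj_on_def)
  also have "\<dots> = card ?C + card ?U"
    by (rule card_Un_disjoint) (auto dest: arg_cong[of _ _ length])
  also have "card ?C = ?m" by (subst card_image) (auto simp: inj_on_def)
  finally show ?thesis using k by simp
qed

end

theory Submission
  imports Defs "HOL-Analysis.L2_Norm" "HOL-Analysis.Convex"
begin

text \<open>
  The energy is the trace norm of the adjacency matrix, so it can be estimated without knowing
  the spectrum. Put \<open>q = k - 1\<close>.

  Upper bound: the vertices at the levels \<open>l - 1, l - 3, \<dots>\<close> meet every edge exactly once, so the
  tree is an edge-disjoint union of \<open>(q\<^sup>l - 1) / (q - 1)\<close> stars with \<open>k\<close> leaves, each of energy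
  \<open>2 \<surd>k\<close>; the trace norm is subadditive.

  Lower bound: pinch to the disjoint subtrees formed by the last three levels. For \<open>l \<ge> 3\<close> these
  are \<open>k q\<^sup>l\<^sup>-\<^sup>3\<close> trees of energy \<open>2 \<surd>q (q - 1 + \<surd>2)\<close>, and for \<open>l = 2\<close> there is only the dendrimer
  itself. The trace norm dominates the pairing with the contraction that is the polar factor
  of the pinched matrix.
\<close>

section \<open>Unitary diagonalization and the energy\<close>

lemma mat_adjoint_carrier [simp, intro]:
  "A \<in> carrier_mat n m \<Longrightarrow> mat_adjoint A \<in> carrier_mat m n"
  by (auto simp: mat_adjoint_def mat_of_rows_def)

lemma index_mat_adjoint [simp]:
  "i < dim_col A \<Longrightarrow> j < dim_row A \<Longrightarrow> mat_adjoint A $$ (i, j) = conjugate (A $$ (j, i))"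
  by (simp add: mat_adjoint_def mat_of_rows_index)

lemma dim_mat_adjoint [simp]:
  "dim_row (mat_adjoint A) = dim_col A" "dim_col (mat_adjoint A) = dim_row A"
  by (auto simp: mat_adjoint_def)

lemma mat_adjoint_adjoint [simp]: "mat_adjoint (mat_adjoint A) = A"
  by (rule eq_matI) auto

lemma mat_adjoint_mult:
  fixes A B :: "complex mat"
  assumes A: "A \<in> carrier_mat n m" and B: "B \<in> carrier_mat m p"
  shows "mat_adjoint (A * B) = mat_adjoint B * mat_adjoint A"
  using assms by (intro eq_matI) (auto simp: scalar_prod_def mult.commute intro!: sum.cong)

definition unitary_mat :: "nat \<Rightarrow> complex mat \<Rightarrow> bool" where
  "unitary_mat n U \<longleftrightarrow> U \<in> carrier_mat n n \<and> mat_adjoint U * U = 1\<^sub>m n"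

lemma unitary_matD:
  assumes "unitary_mat n U"
  shows "U \<in> carrier_mat n n" "mat_adjoint U * U = 1\<^sub>m n" "U * mat_adjoint U = 1\<^sub>m n"
  using assms mat_mult_left_right_inverse[of "mat_adjoint U" n U]
  by (auto simp: unitary_mat_def)

lemma unitary_mat_mult:
  assumes "unitary_mat n U" "unitary_mat n V"
  shows "unitary_mat n (U * V)"
proof -
  note U = unitary_matD[OF assms(1)] and V = unitary_matD[OF assms(2)]
  have c: "mat_adjoint U \<in> carrier_mat n n" "mat_adjoint V \<in> carrier_mat n n" using U V by auto
  have "mat_adjoint (U * V) * (U * V) = mat_adjoint V * (mat_adjoint U * (U * V))"
    using U(1) V(1) c by (simp add: mat_adjoint_mult assoc_mult_mat[of _ n n _ n _ n])
  also have "mat_adjoint U * (U * V) = (mat_adjoint U * U) * V"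
    using U(1) V(1) c by (simp only: assoc_mult_mat[of _ n n _ n _ n])
  finally show ?thesis using U V by (simp add: unitary_mat_def)
qed

lemma unitary_mat_four_block:
  assumes "unitary_mat n U"
  shows "unitary_mat (Suc n) (four_block_mat (1\<^sub>m 1) (0\<^sub>m 1 n) (0\<^sub>m n 1) U)" (is "unitary_mat _ ?V")
proof -
  note U = unitary_matD[OF assms]
  have adj: "mat_adjoint ?V = four_block_mat (1\<^sub>m 1) (0\<^sub>m 1 n) (0\<^sub>m n 1) (mat_adjoint U)"
    using U(1) by (intro eq_matI) auto
  have "mat_adjoint ?V * ?V = four_block_mat (1\<^sub>m 1) (0\<^sub>m 1 n) (0\<^sub>m n 1) (1\<^sub>m n)"
    unfolding adj using U
    by (subst mult_four_block_mat[of _ 1 1 _ n _ n _ _ 1 _ n]) auto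
  then show ?thesis
    using U(1) by (auto simp: unitary_mat_def)
qed

text \<open>Gram-Schmidt on a basis starting with \<open>v\<close> keeps \<open>v\<close> as first
  vector. Its output is orthogonal but not normalized; dividing each vector by its norm gives the
  columns of \<open>W\<close>, so column 0 is a multiple of \<open>v\<close>.\<close>

lemma unitary_completion:
  fixes v :: "complex vec"
  assumes v: "v \<in> carrier_vec n" and v0: "v \<noteq> 0\<^sub>v n"
  shows "\<exists>W c. unitary_mat n W \<and> col W 0 = c \<cdot>\<^sub>v v"
proof -
  interpret cof_vec_space n "TYPE(complex)" .
  define b where "b = basis_completion v"
  define ws where "ws = gram_schmidt n b"
  note b = basis_completion[OF v v0, folded b_def]
  have n: "n \<noteq> 0" using v v0 by (auto intro: eq_vecI)
  obtain vs where bv: "b = v # vs" using b n by (cases b) auto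
  note gs = gram_schmidt_result[OF b(2) b(4) b(5) ws_def]
  have hd: "hd ws = v"
    using gram_schmidt_hd[OF v, of vs, folded bv] unfolding ws_def .
  have len: "length ws = n" using gs b by simp
  have wsn: "ws ! i \<in> carrier_vec n" if "i < n" for i using gs(3) that len by auto
  \<comment> \<open>In the order on the complex numbers, being at least 0 includes being real; a
    nonzero such value is a positive real.\<close>
  have pos: "\<exists>r>0. ws ! i \<bullet>c ws ! i = complex_of_real r" if "i < n" for i
  proof -
    have "ws ! i \<bullet>c ws ! i \<noteq> 0" using corthogonalD[OF gs(2), of i i] that len by auto
    moreover have "ws ! i \<bullet>c ws ! i \<ge> 0" by (rule conjugate_square_ge_0_vec)
    ultimately show ?thesis
      by (intro exI[of _ "Re (ws ! i \<bullet>c ws ! i)"]) (auto simp: less_eq_complex_def complex_eq_iff)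
  qed
  then obtain r where r: "\<And>i. i < n \<Longrightarrow> r i > 0 \<and> ws ! i \<bullet>c ws ! i = complex_of_real (r i)"
    by metis
  define W where "W = mat n n (\<lambda>(i, j). complex_of_real (1 / sqrt (r j)) * (ws ! j $ i))"
  have W: "W \<in> carrier_mat n n" by (simp add: W_def)
  have "mat_adjoint W * W = 1\<^sub>m n"
  proof (rule eq_matI)
    fix i j assume "i < dim_row (1\<^sub>m n :: complex mat)" "j < dim_col (1\<^sub>m n :: complex mat)"
    then have ij: "i < n" "j < n" by auto
    have "(mat_adjoint W * W) $$ (i, j) =
        (\<Sum>m\<in>{0..<n}. complex_of_real (1 / sqrt (r i)) * complex_of_real (1 / sqrt (r j)) *
          (ws ! j $ m * cnj (ws ! i $ m)))"
      using ij W by (simp add: scalar_prod_def) (simp add: W_def field_simps)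
    also have "\<dots> = complex_of_real (1 / sqrt (r i)) * complex_of_real (1 / sqrt (r j)) *
                     (ws ! j \<bullet>c ws ! i)"
      using wsn[OF ij(1)] by (simp add: scalar_prod_def sum_distrib_left)
    also have "\<dots> = (1\<^sub>m n :: complex mat) $$ (i, j)"
    proof (cases "i = j")
      case True
      have "1 / sqrt (r i) * (1 / sqrt (r i)) * r i = 1" using r[OF ij(1)] by simp
      then have "complex_of_real (1 / sqrt (r i) * (1 / sqrt (r i)) * r i) = 1" by simp
      then show ?thesis using True r[OF ij(1)] ij by (simp only: of_real_mult) simp
    next
      case False
      then show ?thesis using corthogonalD[OF gs(2), of j i] ij len by auto
    qed
    finally show "(mat_adjoint W * W) $$ (i, j) = (1\<^sub>m n :: complex mat) $$ (i, j)" .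
  qed (use W in auto)
  moreover have "col W 0 = complex_of_real (1 / sqrt (r 0)) \<cdot>\<^sub>v v"
  proof -
    have "ws ! 0 = v" using n hd len by (cases ws) auto
    then show ?thesis using n v by (intro eq_vecI) (auto simp: W_def)
  qed
  ultimately show ?thesis using W unfolding unitary_mat_def by blast
qed

text \<open>Deflation: pass to an orthonormal basis whose first vector is an eigenvector. The new
  matrix is again Hermitian, so the zeros below the corner recur to its right, and the remaining
  block is Hermitian of size \<open>n\<close>.\<close>

theorem hermitian_unitarily_diagonalizable:
  fixes A :: "complex mat"
  assumes "A \<in> carrier_mat n n" and "mat_adjoint A = A"
  shows "\<exists>U D. unitary_mat n U \<and> D \<in> carrier_mat n n \<and> diagonal_mat D \<and> A * U = U * D"
  using assms
proof (induction n arbitrary: A)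
  case 0
  have "unitary_mat 0 (1\<^sub>m 0)" by (auto simp: unitary_mat_def intro!: eq_matI)
  moreover have "diagonal_mat A" using 0 by (auto simp: diagonal_mat_def)
  moreover have "A * 1\<^sub>m 0 = 1\<^sub>m 0 * A" using 0 by (auto intro!: eq_matI)
  ultimately show ?case using 0 by blast
next
  case (Suc n)
  note A = Suc.prems(1)
  obtain e where e: "eigenvalue A e"
    using spectrum_non_empty[OF A] by (auto simp: spectrum_def)
  then obtain v where v: "v \<in> carrier_vec (Suc n)" "v \<noteq> 0\<^sub>v (Suc n)" "A *\<^sub>v v = e \<cdot>\<^sub>v v"
    using A by (auto simp: eigenvalue_def eigenvector_def)
  obtain W c where Wu: "unitary_mat (Suc n) W" and Wc: "col W 0 = c \<cdot>\<^sub>v v"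
    using unitary_completion[OF v(1,2)] by blast
  note W = unitary_matD[OF Wu]
  have W': "mat_adjoint W \<in> carrier_mat (Suc n) (Suc n)" using W by auto
  define B where "B = mat_adjoint W * (A * W)"
  have B: "B \<in> carrier_mat (Suc n) (Suc n)" using A W by (auto simp: B_def)
  have Bh: "mat_adjoint B = B"
    using A W(1) W' Suc.prems(2)
    by (simp add: B_def mat_adjoint_mult[of _ "Suc n" "Suc n" _ "Suc n"] assoc_mult_mat[of _ "Suc n" "Suc n" _ "Suc n" _ "Suc n"])
  have WB: "W * B = A * W"
  proof -
    have "W * B = (W * mat_adjoint W) * (A * W)"
      unfolding B_def using A W(1) W' by (subst assoc_mult_mat[of _ "Suc n" "Suc n" _ "Suc n" _ "Suc n"]) auto
    then show ?thesis using W A by simp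
  qed
  have "A *\<^sub>v col W 0 = e \<cdot>\<^sub>v col W 0"
    unfolding Wc using v A by (simp add: mult_mat_vec smult_smult_assoc mult.commute)
  then have col0: "col (A * W) 0 = e \<cdot>\<^sub>v col W 0"
    unfolding col_mult2[OF A W(1) zero_less_Suc] .
  have colB: "B $$ (i, 0) = (if i = 0 then e else 0)" if "i < Suc n" for i
  proof -
    have "B $$ (i, 0) = row (mat_adjoint W) i \<bullet> (e \<cdot>\<^sub>v col W 0)"
      unfolding B_def using that A W col0 by simp
    also have "\<dots> = e * (row (mat_adjoint W) i \<bullet> col W 0)"
      using W by (simp add: scalar_prod_smult_distrib)
    also have "row (mat_adjoint W) i \<bullet> col W 0 = (mat_adjoint W * W) $$ (i, 0)"
      using W(1) that by simp
    finally show ?thesis using W(2) that by simp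
  qed
  have rowB: "B $$ (0, j) = (if j = 0 then e else 0)" if "j < Suc n" for j
  proof -
    have "B $$ (0, j) = mat_adjoint B $$ (0, j)" using Bh by simp
    also have "\<dots> = cnj (B $$ (j, 0))" using B that by simp
    finally show ?thesis using colB[OF that] colB[of 0] Bh that by (cases "j = 0") auto
  qed
  define C where "C = mat n n (\<lambda>(i, j). B $$ (Suc i, Suc j))"
  have C: "C \<in> carrier_mat n n" by (simp add: C_def)
  have BC: "B = four_block_mat (mat 1 1 (\<lambda>_. e)) (0\<^sub>m 1 n) (0\<^sub>m n 1) C"
    using B colB rowB by (intro eq_matI) (auto simp: C_def)
  have "mat_adjoint C = C"
  proof (rule eq_matI)
    fix i j assume ij: "i < dim_row C" "j < dim_col C"
    then have "mat_adjoint B $$ (Suc i, Suc j) = cnj (B $$ (Suc j, Suc i))" using B C by simp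
    then show "mat_adjoint C $$ (i, j) = C $$ (i, j)" using Bh ij C by (simp add: C_def)
  qed (use C in auto)
  from Suc.IH[OF C this] obtain U D where
    U: "unitary_mat n U" and D: "D \<in> carrier_mat n n" "diagonal_mat D" "C * U = U * D" by blast
  have Uc: "U \<in> carrier_mat n n" using unitary_matD[OF U] by simp
  define V where "V = four_block_mat (1\<^sub>m 1) (0\<^sub>m 1 n) (0\<^sub>m n 1) U"
  define D' where "D' = four_block_mat (mat 1 1 (\<lambda>_. e)) (0\<^sub>m 1 n) (0\<^sub>m n 1) D"
  have V: "unitary_mat (Suc n) V" unfolding V_def by (rule unitary_mat_four_block[OF U])
  note V' = unitary_matD(1)[OF V]
  have D': "D' \<in> carrier_mat (Suc n) (Suc n)" "diagonal_mat D'"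
    using D by (auto simp: D'_def diagonal_mat_def)
  have BV: "B * V = V * D'"
    unfolding BC V_def D'_def using C Uc D
    by (subst (1 2) mult_four_block_mat[of _ 1 1 _ n _ n _ _ 1 _ n]) auto
  have "A * (W * V) = (A * W) * V"
    using A W(1) V' by (simp add: assoc_mult_mat[of _ "Suc n" "Suc n" _ "Suc n" _ "Suc n"])
  also have "\<dots> = W * (B * V)"
    unfolding WB[symmetric] using B W(1) V' by (simp add: assoc_mult_mat[of _ "Suc n" "Suc n" _ "Suc n" _ "Suc n"])
  also have "\<dots> = (W * V) * D'"
    unfolding BV using D' W(1) V' by (simp add: assoc_mult_mat[of _ "Suc n" "Suc n" _ "Suc n" _ "Suc n"])
  finally show ?case using unitary_mat_mult[OF Wu V] D' by blast
qed

section \<open>The energy read off a diagonalization\<close>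

lemma sum_order_prod_list:
  fixes g :: "complex \<Rightarrow> real"
  assumes "finite S" "set xs \<subseteq> S"
  shows "(\<Sum>x\<in>S. real (order x (\<Prod>a\<leftarrow>xs. [:- a, 1:])) * g x) = (\<Sum>x\<leftarrow>xs. g x)"
  using assms(2)
proof (induction xs)
  case Nil
  have "order x (1 :: complex poly) = 0" for x by (simp add: order_0I)
  then show ?case by simp
next
  case (Cons a xs)
  have nz: "[:- a, 1:] * (\<Prod>a\<leftarrow>xs. [:- a, 1:]) \<noteq> 0"
    by (auto simp: prod_list_zero_iff simp del: mult_pCons_left)
  \<comment> \<open>The factor of \<open>a\<close> raises the order by one at \<open>a\<close> and
    nowhere else, and \<open>a\<close> lies in \<open>S\<close>.\<close>
  have "(\<Sum>x\<in>S. real (order x (\<Prod>a\<leftarrow>a # xs. [:- a, 1:])) * g x) =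
     (\<Sum>x\<in>S. (if x = a then g x else 0) + real (order x (\<Prod>a\<leftarrow>xs. [:- a, 1:])) * g x)"
    by (intro sum.cong)
      (auto simp: order_mult[OF nz] order_linear' ring_distribs simp del: mult_pCons_left)
  also have "\<dots> = g a + (\<Sum>x\<leftarrow>xs. g x)"
    using Cons assms(1) by (simp add: sum.distrib)
  finally show ?case by simp
qed

lemma matrix_energy_eq_sum_diag:
  assumes A: "A \<in> carrier_mat n n" and U: "unitary_mat n U"
    and D: "D \<in> carrier_mat n n" "diagonal_mat D" and AU: "A * U = U * D"
  shows "matrix_energy A = (\<Sum>i<n. cmod (D $$ (i, i)))"
proof -
  note U' = unitary_matD[OF U]
  have adj: "mat_adjoint U \<in> carrier_mat n n" using U' by auto
  have "A = A * (U * mat_adjoint U)" using A U' by simp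
  also have "\<dots> = U * D * mat_adjoint U"
    using A U'(1) adj AU by (subst assoc_mult_mat[symmetric, of _ n n _ n _ n]) auto
  finally have "A = U * D * mat_adjoint U" .
  then have "similar_mat A D"
    by (rule similar_matI[rotated -1]) (use A D(1) adj U' in auto)
  then have "char_poly A = char_poly D" by (rule char_poly_similar)
  also have "\<dots> = (\<Prod>a\<leftarrow>diag_mat D. [:- a, 1:])"
    using D by (intro char_poly_upper_triangular[OF D(1)]) (auto simp: diagonal_mat_def)
  finally have cp: "char_poly A = (\<Prod>a\<leftarrow>diag_mat D. [:- a, 1:])" .
  \<comment> \<open>Every diagonal entry is a root of the characteristic polynomial, so summing over
    the spectrum loses none of them.\<close>
  have "set (diag_mat D) \<subseteq> spectrum A"
    unfolding spectrum_def using eigenvalue_root_char_poly[OF A]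
    by (auto simp: cp poly_prod_list prod_list_zero_iff o_def)
  then have "matrix_energy A = (\<Sum>x\<leftarrow>diag_mat D. cmod x)"
    unfolding matrix_energy_def cp
    by (rule sum_order_prod_list[OF card_finite_spectrum(1)[OF A]])
  also have "\<dots> = (\<Sum>i<n. cmod (D $$ (i, i)))"
    using D(1) by (simp add: diag_mat_def sum_list_sum_nth atLeast0LessThan o_def)
  finally show ?thesis .
qed

section \<open>Bounds for the energy of a graph\<close>

definition adj :: "'a pair_pre_digraph \<Rightarrow> 'a \<Rightarrow> 'a \<Rightarrow> real" where
  "adj G u v = of_bool ((u, v) \<in> parcs G)"

lemma adj_sym: "pair_graph G \<Longrightarrow> adj G u v = adj G v u"
  using pair_sym_digraph.arcs_symmetric[of G] by (auto simp: adj_def pair_graph_def pair_pseudo_graph_def)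

text \<open>The functions \<open>f\<close> are the real and imaginary parts of an orthonormal basis of complex
  eigenvectors: a Parseval frame of real eigenvectors rather than a basis.\<close>

lemma real_eigenframe:
  fixes G :: "'a pair_pre_digraph"
  assumes G: "pair_graph G"
  obtains J :: "(nat \<times> bool) set" and \<mu> :: "nat \<times> bool \<Rightarrow> real" and f :: "nat \<times> bool \<Rightarrow> 'a \<Rightarrow> real"
  where "finite J"
    and "\<And>j u. j \<in> J \<Longrightarrow> u \<in> pverts G \<Longrightarrow> (\<Sum>v\<in>pverts G. adj G u v * f j v) = \<mu> j * f j u"
    and "\<And>u v. u \<in> pverts G \<Longrightarrow> v \<in> pverts G \<Longrightarrow>
           (\<Sum>j\<in>J. f j u * f j v) = of_bool (u = v)"
    and "graph_energy G = (\<Sum>j\<in>J. \<bar>\<mu> j\<bar> * (\<Sum>v\<in>pverts G. (f j v)\<^sup>2))"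
proof -
  let ?V = "pverts G"
  interpret pair_graph G by (rule G)
  obtain vs where vs: "distinct vs" "set vs = ?V"
    using finite_distinct_list[of ?V] by auto
  define n where "n = length vs"
  define A where "A = adjacency_matrix G vs"
  have A: "A \<in> carrier_mat n n"
    unfolding A_def n_def by (rule adjacency_matrix_carrier)
  have Aij: "A $$ (i, j) = complex_of_real (adj G (vs ! i) (vs ! j))" if "i < n" "j < n" for i j
    using that by (simp add: A_def adjacency_matrix_def adj_def n_def)
  have herm: "mat_adjoint A = A"
    using A by (intro eq_matI) (auto simp: Aij adj_sym[OF G])
  obtain U D where U: "unitary_mat n U" and D: "D \<in> carrier_mat n n" "diagonal_mat D"
    and AU: "A * U = U * D"
    using hermitian_unitarily_diagonalizable[OF A herm] by blast
  note U' = unitary_matD[OF U]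
  have adj: "mat_adjoint U \<in> carrier_mat n n" using U' by auto
  \<comment> \<open>This form shows that \<open>D\<close> is Hermitian, so its diagonal is real. As
    the adjacency matrix is real too, the real and imaginary parts of each column of
    \<open>U\<close> satisfy the eigenvalue equation separately.\<close>
  have "D = mat_adjoint U * (A * U)"
    unfolding AU using U' D adj
    by (subst assoc_mult_mat[symmetric, of _ n n _ n _ n]) auto
  moreover have "mat_adjoint (mat_adjoint U * (A * U)) = mat_adjoint U * (A * U)"
    using A U'(1) adj herm
    by (simp add: mat_adjoint_mult[of _ n n _ n] assoc_mult_mat[of _ n n _ n _ n])
  ultimately have Dh: "mat_adjoint D = D" by simp
  have Dreal: "D $$ (i, i) = complex_of_real (Re (D $$ (i, i)))" if "i < n" for i
  proof -
    have "cnj (D $$ (i, i)) = D $$ (i, i)"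
      using arg_cong[OF Dh, of "\<lambda>M. M $$ (i, i)"] D that by simp
    then show ?thesis by (simp add: complex_eq_iff)
  qed
  have bij: "bij_betw ((!) vs) {..<n} ?V"
    using bij_betw_nth[OF vs(1), of "{..<n}" ?V] vs n_def by simp
  define ix where "ix = the_inv_into {..<n} ((!) vs)"
  have ix: "ix (vs ! i) = i" if "i < n" for i
    unfolding ix_def using bij that by (simp add: the_inv_into_f_f bij_betw_def)
  have ex: "\<exists>i<n. u = vs ! i" if "u \<in> ?V" for u
    using that vs(2) n_def by (metis in_set_conv_nth)
  have sumV: "(\<Sum>v\<in>?V. h v) = (\<Sum>i<n. h (vs ! i))" for h :: "'a \<Rightarrow> real"
    using sum.reindex_bij_betw[OF bij, of h] by simp
  define f where "f = (\<lambda>(i, b) v. if b then Re (U $$ (ix v, i)) else Im (U $$ (ix v, i)))"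
  define \<mu> where "\<mu> = (\<lambda>(i, b :: bool). Re (D $$ (i, i)))"
  let ?J = "{..<n} \<times> (UNIV :: bool set)"
  have sumJ: "(\<Sum>j\<in>?J. h j) = (\<Sum>i<n. h (i, True) + h (i, False))" for h :: "nat \<times> bool \<Rightarrow> real"
  proof -
    have "(\<Sum>j\<in>?J. h j) = (\<Sum>i<n. \<Sum>b\<in>UNIV. h (i, b))"
      by (simp only: sum.cartesian_product) (simp add: split_def)
    then show ?thesis by (simp add: UNIV_bool add.commute)
  qed
  show thesis
  proof (rule that[of ?J f \<mu>])
    show "finite ?J" by simp
  next
    fix j u assume j: "j \<in> ?J" and u: "u \<in> ?V"
    obtain i b where jb: "j = (i, b)" "i < n" using j by auto
    obtain p where p: "p < n" "u = vs ! p" using ex[OF u] by blast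
    have "(A * U) $$ (p, i) = (\<Sum>m<n. complex_of_real (adj G u (vs ! m)) * U $$ (m, i))"
      using A U'(1) p jb by (simp add: scalar_prod_def Aij atLeast0LessThan)
    moreover have "(U * D) $$ (p, i) = (\<Sum>m<n. U $$ (p, m) * D $$ (m, i))"
      using D U'(1) p jb by (simp add: scalar_prod_def atLeast0LessThan)
    moreover have "\<dots> = (\<Sum>m<n. if m = i then U $$ (p, i) * D $$ (i, i) else 0)"
      using D jb by (intro sum.cong) (auto simp: diagonal_mat_def)
    ultimately have "(\<Sum>m<n. complex_of_real (adj G u (vs ! m)) * U $$ (m, i)) =
        U $$ (p, i) * complex_of_real (Re (D $$ (i, i)))"
      using AU jb Dreal by simp
    from arg_cong[OF this, of Re] arg_cong[OF this, of Im]
    show "(\<Sum>v\<in>?V. adj G u v * f j v) = \<mu> j * f j u"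
      using jb p by (simp add: sumV f_def \<mu>_def ix mult.commute)
  next
    fix u v assume u: "u \<in> ?V" and v: "v \<in> ?V"
    obtain p where p: "p < n" "u = vs ! p" using ex[OF u] by blast
    obtain r where r: "r < n" "v = vs ! r" using ex[OF v] by blast
    have "(U * mat_adjoint U) $$ (p, r) = (\<Sum>i<n. U $$ (p, i) * cnj (U $$ (r, i)))"
      using U'(1) p r by (simp add: scalar_prod_def atLeast0LessThan)
    then have "(\<Sum>i<n. U $$ (p, i) * cnj (U $$ (r, i))) = (if p = r then 1 else 0)"
      unfolding U'(3) using p r by simp
    from arg_cong[OF this, of Re]
    have "(\<Sum>i<n. Re (U $$ (p, i)) * Re (U $$ (r, i)) + Im (U $$ (p, i)) * Im (U $$ (r, i)))
        = of_bool (p = r)"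
      by (cases "p = r") simp_all
    moreover have "p = r \<longleftrightarrow> u = v"
      using p r vs(1) n_def by (simp add: nth_eq_iff_index_eq)
    ultimately show "(\<Sum>j\<in>?J. f j u * f j v) = of_bool (u = v)"
      using p r unfolding sumJ by (simp add: f_def ix)
  next
    \<comment> \<open>The squared norms of the two parts of a unit column add up to 1, so each pair
      of frame vectors carries total weight 1 and eigenvalues are counted with multiplicity.\<close>
    have one: "(\<Sum>m<n. (Re (U $$ (m, i)))\<^sup>2 + (Im (U $$ (m, i)))\<^sup>2) = 1" if "i < n" for i
    proof -
      have "(mat_adjoint U * U) $$ (i, i) = (\<Sum>m<n. cnj (U $$ (m, i)) * U $$ (m, i))"
        using U'(1) that by (simp add: scalar_prod_def atLeast0LessThan)
      then have "Re (\<Sum>m<n. cnj (U $$ (m, i)) * U $$ (m, i)) = 1"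
        using that U'(2) by simp
      then show ?thesis by (simp add: power2_eq_square)
    qed
    have "graph_energy G = (\<Sum>i<n. cmod (D $$ (i, i)))"
      using graph_energy_eq[OF vs] matrix_energy_eq_sum_diag[OF A U D AU] by (simp add: A_def)
    also have "\<dots> = (\<Sum>i<n. \<bar>Re (D $$ (i, i))\<bar> *
        (\<Sum>m<n. (Re (U $$ (m, i)))\<^sup>2 + (Im (U $$ (m, i)))\<^sup>2))"
    proof (rule sum.cong[OF refl])
      fix i assume "i \<in> {..<n}"
      then have i: "i < n" by simp
      have "cmod (D $$ (i, i)) = \<bar>Re (D $$ (i, i))\<bar>"
        by (subst Dreal[OF i]) (rule norm_of_real)
      then show "cmod (D $$ (i, i)) = \<bar>Re (D $$ (i, i))\<bar> *
        (\<Sum>m<n. (Re (U $$ (m, i)))\<^sup>2 + (Im (U $$ (m, i)))\<^sup>2)"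
        using one[OF i] by simp
    qed
    also have "\<dots> = (\<Sum>j\<in>?J. \<bar>\<mu> j\<bar> * (\<Sum>v\<in>?V. (f j v)\<^sup>2))"
      unfolding sumJ sumV by (simp add: f_def \<mu>_def ix sum.distrib distrib_left)
    finally show "graph_energy G = (\<Sum>j\<in>?J. \<bar>\<mu> j\<bar> * (\<Sum>v\<in>?V. (f j v)\<^sup>2))" .
  qed
qed

text \<open>Polarized Parseval identity. Restricting \<open>a\<close> to \<open>Y\<close> amounts to
  extending it by zero, which allows pairing a row supported on some of the vertices with a full
  row.\<close>

lemma sum_frame_product:
  fixes f :: "'j \<Rightarrow> 'a \<Rightarrow> real"
  assumes frame: "\<And>u v. u \<in> V \<Longrightarrow> v \<in> V \<Longrightarrow> (\<Sum>j\<in>J. f j u * f j v) = of_bool (u = v)"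
    and V: "finite V" and Y: "Y \<subseteq> V"
  shows "(\<Sum>j\<in>J. (\<Sum>v\<in>Y. a v * f j v) * (\<Sum>v\<in>V. b v * f j v)) = (\<Sum>v\<in>Y. a v * b v)"
proof -
  have "(\<Sum>j\<in>J. (\<Sum>v\<in>Y. a v * f j v) * (\<Sum>v\<in>V. b v * f j v)) =
        (\<Sum>j\<in>J. \<Sum>u\<in>Y. \<Sum>v\<in>V. a u * b v * (f j u * f j v))"
    by (simp add: sum_product mult_ac)
  also have "\<dots> = (\<Sum>u\<in>Y. \<Sum>v\<in>V. a u * b v * (\<Sum>j\<in>J. f j u * f j v))"
    unfolding sum_distrib_left
    by (subst sum.swap, rule sum.cong[OF refl], rule sum.swap)
  also have "\<dots> = (\<Sum>u\<in>Y. \<Sum>v\<in>V. if u = v then a u * b v else 0)"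
    using Y by (intro sum.cong refl) (auto simp: frame subset_iff)
  also have "\<dots> = (\<Sum>u\<in>Y. a u * b u)"
    using Y V by (intro sum.cong) (auto simp: subset_iff)
  finally show ?thesis .
qed

lemma out_degree_eq_sum_adj:
  assumes G: "pair_graph G"
  shows "real (out_degree G u) = (\<Sum>v\<in>pverts G. (adj G u v)\<^sup>2)"
proof -
  interpret pair_graph G by (rule G)
  have "out_arcs G u = Pair u ` {v \<in> pverts G. (u, v) \<in> parcs G}"
    by (auto simp: out_arcs_def image_iff dest: in_arcsD2)
  then have "out_degree G u = card {v \<in> pverts G. (u, v) \<in> parcs G}"
    by (simp add: out_degree_def card_image inj_on_def)
  also have "real \<dots> = (\<Sum>v\<in>pverts G. (adj G u v)\<^sup>2)"
    by (simp add: adj_def power2_eq_square Int_def flip: of_bool_conj)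
  finally show ?thesis .
qed

text \<open>The stars centred in \<open>X\<close> contain every edge exactly once. The quadratic
  form of a frame vector is therefore twice the part coming from \<open>X\<close>; summed over the
  frame, Cauchy-Schwarz bounds the share of each centre by the norm of its adjacency row.\<close>

theorem graph_energy_le_sum_sqrt_degree:
  assumes G: "pair_graph G" and X: "X \<subseteq> pverts G"
    and bip: "\<And>u v. (u, v) \<in> parcs G \<Longrightarrow> u \<in> X \<longleftrightarrow> v \<notin> X"
  shows "graph_energy G \<le> 2 * (\<Sum>c\<in>X. sqrt (real (out_degree G c)))"
proof -
  let ?V = "pverts G"
  interpret pair_graph G by (rule G)
  obtain J :: "(nat \<times> bool) set" and \<mu> :: "nat \<times> bool \<Rightarrow> real"
    and f :: "nat \<times> bool \<Rightarrow> 'a \<Rightarrow> real" where J: "finite J"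
    and ev: "\<And>j u. j \<in> J \<Longrightarrow> u \<in> ?V \<Longrightarrow> (\<Sum>v\<in>?V. adj G u v * f j v) = \<mu> j * f j u"
    and frame: "\<And>u v. u \<in> ?V \<Longrightarrow> v \<in> ?V \<Longrightarrow> (\<Sum>j\<in>J. f j u * f j v) = of_bool (u = v)"
    and energy: "graph_energy G = (\<Sum>j\<in>J. \<bar>\<mu> j\<bar> * (\<Sum>v\<in>?V. (f j v)\<^sup>2))"
    by (rule real_eigenframe[OF G]) (rule that)
  have fV: "finite ?V" by simp
  have fX: "finite X" using finite_subset[OF X] by auto
  define S where "S j c = (\<Sum>v\<in>?V. adj G c v * f j v)" for j c
  \<comment> \<open>No edge stays on one side and \<open>adj\<close> is symmetric, so each edge
    contributes equally from its two ends.\<close>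
  have half: "(\<Sum>u\<in>?V - X. f j u * S j u) = (\<Sum>c\<in>X. f j c * S j c)" for j
  proof -
    have a0: "adj G u v = 0" if "u \<in> X \<longleftrightarrow> v \<in> X" for u v
      using bip[of u v] that by (auto simp: adj_def)
    have "(\<Sum>u\<in>?V - X. f j u * S j u) = (\<Sum>u\<in>?V - X. f j u * (\<Sum>c\<in>X. adj G u c * f j c))"
      unfolding S_def using X
      by (intro sum.cong refl arg_cong2[of _ _ _ _ "(*)"] sum.mono_neutral_right) (auto simp: a0)
    also have "\<dots> = (\<Sum>c\<in>X. f j c * (\<Sum>u\<in>?V - X. adj G c u * f j u))"
      unfolding sum_distrib_left
      by (subst sum.swap) (simp add: mult_ac adj_sym[OF G])
    also have "\<dots> = (\<Sum>c\<in>X. f j c * S j c)"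
      unfolding S_def using X
      by (intro sum.cong refl arg_cong2[of _ _ _ _ "(*)"] sum.mono_neutral_left) (auto simp: a0)
    finally show ?thesis .
  qed
  have le: "\<bar>\<mu> j\<bar> * (\<Sum>v\<in>?V. (f j v)\<^sup>2) \<le> 2 * (\<Sum>c\<in>X. \<bar>f j c\<bar> * \<bar>S j c\<bar>)" if "j \<in> J" for j
  proof -
    have "\<bar>\<mu> j\<bar> * (\<Sum>v\<in>?V. (f j v)\<^sup>2) = \<bar>\<Sum>v\<in>?V. f j v * (\<mu> j * f j v)\<bar>"
    proof -
      have "(\<Sum>v\<in>?V. f j v * (\<mu> j * f j v)) = \<mu> j * (\<Sum>v\<in>?V. (f j v)\<^sup>2)"
        by (simp add: sum_distrib_left power2_eq_square mult_ac)
      then show ?thesis by (simp add: abs_mult sum_nonneg)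
    qed
    also have "(\<Sum>v\<in>?V. f j v * (\<mu> j * f j v)) = (\<Sum>v\<in>?V. f j v * S j v)"
      using ev[OF that] by (simp add: S_def)
    also have "\<dots> = 2 * (\<Sum>c\<in>X. f j c * S j c)"
      using sum.subset_diff[OF X, of "\<lambda>v. f j v * S j v"] half[of j] by simp
    also have "\<bar>\<dots>\<bar> \<le> 2 * (\<Sum>c\<in>X. \<bar>f j c\<bar> * \<bar>S j c\<bar>)"
      using sum_abs[of "\<lambda>c. f j c * S j c" X] by (simp add: abs_mult)
    finally show ?thesis .
  qed
  have "graph_energy G \<le> (\<Sum>j\<in>J. 2 * (\<Sum>c\<in>X. \<bar>f j c\<bar> * \<bar>S j c\<bar>))"
    unfolding energy by (rule sum_mono[OF le])
  also have "\<dots> = 2 * (\<Sum>c\<in>X. \<Sum>j\<in>J. \<bar>f j c\<bar> * \<bar>S j c\<bar>)"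
    unfolding sum_distrib_left by (rule sum.swap)
  also have "\<dots> \<le> 2 * (\<Sum>c\<in>X. sqrt (real (out_degree G c)))"
  proof (intro mult_left_mono sum_mono)
    fix c assume "c \<in> X"
    then have c: "c \<in> ?V" using X by auto
    \<comment> \<open>Parseval for row \<open>c\<close> of the adjacency matrix: its entries are 0
      or 1, so its squared norm is the degree.\<close>
    have "(\<Sum>j\<in>J. (S j c)\<^sup>2) = real (out_degree G c)"
      using sum_frame_product[where a = "adj G c" and b = "adj G c", OF frame fV order_refl]
        out_degree_eq_sum_adj[OF G, of c] by (simp add: S_def power2_eq_square)
    moreover have "(\<Sum>j\<in>J. (f j c)\<^sup>2) = 1"
      using frame[OF c c] by (simp add: power2_eq_square)
    ultimately show "(\<Sum>j\<in>J. \<bar>f j c\<bar> * \<bar>S j c\<bar>) \<le> sqrt (real (out_degree G c))"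
      using L2_set_mult_ineq[of "\<lambda>j. f j c" "\<lambda>j. S j c" J] by (simp add: L2_set_def)
  qed simp
  finally show ?thesis .
qed

text \<open>Duality between the trace norm and the operator norm: the energy dominates the trace
  of the adjacency matrix against any contraction.\<close>

theorem graph_energy_ge_contraction:
  fixes W :: "'a \<Rightarrow> 'a \<Rightarrow> real"
  assumes G: "pair_graph G" and X: "X \<subseteq> pverts G" and Y: "Y \<subseteq> pverts G" and XY: "X \<inter> Y = {}"
    and W: "\<And>f. (\<Sum>c\<in>X. (\<Sum>v\<in>Y. W c v * f v)\<^sup>2) \<le> (\<Sum>v\<in>Y. (f v)\<^sup>2)"
  shows "2 * (\<Sum>c\<in>X. \<Sum>v\<in>Y. W c v * adj G c v) \<le> graph_energy G"
proof -
  let ?V = "pverts G"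
  interpret pair_graph G by (rule G)
  obtain J :: "(nat \<times> bool) set" and \<mu> :: "nat \<times> bool \<Rightarrow> real"
    and f :: "nat \<times> bool \<Rightarrow> 'a \<Rightarrow> real" where J: "finite J"
    and ev: "\<And>j u. j \<in> J \<Longrightarrow> u \<in> ?V \<Longrightarrow> (\<Sum>v\<in>?V. adj G u v * f j v) = \<mu> j * f j u"
    and frame: "\<And>u v. u \<in> ?V \<Longrightarrow> v \<in> ?V \<Longrightarrow> (\<Sum>j\<in>J. f j u * f j v) = of_bool (u = v)"
    and energy: "graph_energy G = (\<Sum>j\<in>J. \<bar>\<mu> j\<bar> * (\<Sum>v\<in>?V. (f j v)\<^sup>2))"
    by (rule real_eigenframe[OF G]) (rule that)
  have fV: "finite ?V" by simp
  have fin: "finite X" "finite Y" using finite_subset[OF X] finite_subset[OF Y] by auto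
  define y where "y j c = (\<Sum>v\<in>Y. W c v * f j v)" for j c
  \<comment> \<open>AM-GM at each \<open>c\<close>; then the contraction property replaces the
    squares of \<open>y\<close> over \<open>X\<close> by those of \<open>f\<close> over
    \<open>Y\<close>, and disjointness of \<open>X\<close> and \<open>Y\<close> leaves at most the
    squared norm of \<open>f j\<close>.\<close>
  have le: "2 * (\<Sum>c\<in>X. y j c * (\<mu> j * f j c)) \<le> \<bar>\<mu> j\<bar> * (\<Sum>v\<in>?V. (f j v)\<^sup>2)" for j
  proof -
    have "2 * (y j c * (\<mu> j * f j c)) \<le> \<bar>\<mu> j\<bar> * ((y j c)\<^sup>2 + (f j c)\<^sup>2)" for c
    proof -
      have "2 * (y j c * f j c) \<le> (y j c)\<^sup>2 + (f j c)\<^sup>2" "- (2 * (y j c * f j c)) \<le> (y j c)\<^sup>2 + (f j c)\<^sup>2"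
        using zero_le_power2[of "y j c - f j c"] zero_le_power2[of "y j c + f j c"]
        by (simp_all add: power2_eq_square algebra_simps)
      then have "\<bar>2 * (y j c * f j c)\<bar> \<le> (y j c)\<^sup>2 + (f j c)\<^sup>2" by (rule abs_leI)
      then have "\<bar>\<mu> j\<bar> * \<bar>2 * (y j c * f j c)\<bar> \<le> \<bar>\<mu> j\<bar> * ((y j c)\<^sup>2 + (f j c)\<^sup>2)"
        by (rule mult_left_mono) simp
      moreover have "2 * (y j c * (\<mu> j * f j c)) \<le> \<bar>\<mu> j\<bar> * \<bar>2 * (y j c * f j c)\<bar>"
        using abs_ge_self[of "\<mu> j * (2 * (y j c * f j c))"] by (simp add: abs_mult mult_ac)
      ultimately show ?thesis by linarith
    qed
    then have "2 * (\<Sum>c\<in>X. y j c * (\<mu> j * f j c)) \<le> (\<Sum>c\<in>X. \<bar>\<mu> j\<bar> * ((y j c)\<^sup>2 + (f j c)\<^sup>2))"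
      unfolding sum_distrib_left by (rule sum_mono)
    also have "\<dots> = \<bar>\<mu> j\<bar> * ((\<Sum>c\<in>X. (y j c)\<^sup>2) + (\<Sum>c\<in>X. (f j c)\<^sup>2))"
      by (simp add: sum.distrib sum_distrib_left distrib_left)
    also have "\<dots> \<le> \<bar>\<mu> j\<bar> * ((\<Sum>v\<in>Y. (f j v)\<^sup>2) + (\<Sum>c\<in>X. (f j c)\<^sup>2))"
      using W[of "f j"] by (intro mult_left_mono) (auto simp: y_def)
    also have "\<dots> = \<bar>\<mu> j\<bar> * (\<Sum>v\<in>Y \<union> X. (f j v)\<^sup>2)"
      using fin XY by (subst sum.union_disjoint) auto
    also have "\<dots> \<le> \<bar>\<mu> j\<bar> * (\<Sum>v\<in>?V. (f j v)\<^sup>2)"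
      using X Y by (intro mult_left_mono sum_mono2) auto
    finally show ?thesis .
  qed
  \<comment> \<open>Parseval turns the pairing into a sum over the frame, on which the adjacency
    operator acts by the scalar \<open>\<mu> j\<close>.\<close>
  have "(\<Sum>c\<in>X. \<Sum>v\<in>Y. W c v * adj G c v) =
      (\<Sum>c\<in>X. \<Sum>j\<in>J. y j c * (\<Sum>v\<in>?V. adj G c v * f j v))"
    unfolding y_def by (intro sum.cong refl sum_frame_product[symmetric, OF frame fV Y])
  also have "\<dots> = (\<Sum>c\<in>X. \<Sum>j\<in>J. y j c * (\<mu> j * f j c))"
    using X by (intro sum.cong refl arg_cong2[of _ _ _ _ "(*)"] ev) auto
  also have "2 * \<dots> = (\<Sum>j\<in>J. 2 * (\<Sum>c\<in>X. y j c * (\<mu> j * f j c)))"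
    unfolding sum_distrib_left by (rule sum.swap)
  also have "\<dots> \<le> graph_energy G"
    unfolding energy by (rule sum_mono[OF le])
  finally show ?thesis .
qed

section \<open>Dendrimers\<close>

definition dendrimer_level :: "nat \<Rightarrow> nat \<Rightarrow> nat list set" where
  "dendrimer_level k j = {xs \<in> dendrimer_verts j k. length xs = j}"

definition child_count :: "nat \<Rightarrow> nat \<Rightarrow> nat" where
  "child_count k j = (if j = 0 then k else k - 1)"

text \<open>The depth \<open>l\<close> cuts the tree off without changing the levels up to the cut,
  so \<open>dendrimer_level\<close> carries no depth parameter.\<close>

lemma dendrimer_level_eq: "j \<le> l \<Longrightarrow> dendrimer_level k j = {xs \<in> dendrimer_verts l k. length xs = j}"
  by (auto simp: dendrimer_level_def dendrimer_verts_def)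

lemma finite_dendrimer_level [simp]: "finite (dendrimer_level k j)"
  by (simp add: dendrimer_level_def finite_dendrimer_verts)

lemma length_dendrimer_level: "xs \<in> dendrimer_level k j \<Longrightarrow> length xs = j"
  by (simp add: dendrimer_level_def)

lemma dendrimer_level_0: "dendrimer_level k 0 = {[]}"
  by (auto simp: dendrimer_level_def dendrimer_verts_def)

lemma dendrimer_level_Suc:
  "dendrimer_level k (Suc j) =
     (\<lambda>(xs, c). xs @ [c]) ` (dendrimer_level k j \<times> {..<child_count k j})"
proof (rule Set.set_eqI)
  fix ys
  show "ys \<in> dendrimer_level k (Suc j) \<longleftrightarrow>
      ys \<in> (\<lambda>(xs, c). xs @ [c]) ` (dendrimer_level k j \<times> {..<child_count k j})"
  proof (cases ys rule: rev_cases)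
    case Nil
    then show ?thesis by (auto simp: dendrimer_level_def)
  next
    case (snoc xs c)
    have "xs \<in> dendrimer_verts (Suc j) k \<and> length xs = j \<longleftrightarrow> xs \<in> dendrimer_level k j"
      using dendrimer_level_eq[of j "Suc j"] by auto
    then show ?thesis
      unfolding snoc by (auto simp: dendrimer_level_def dendrimer_verts_snoc child_count_def image_iff)
  qed
qed

lemma sum_dendrimer_level_Suc:
  "(\<Sum>xs\<in>dendrimer_level k (Suc j). g xs) =
     (\<Sum>xs\<in>dendrimer_level k j. \<Sum>c<child_count k j. g (xs @ [c]))"
  unfolding dendrimer_level_Suc
  by (subst sum.reindex) (auto simp: inj_on_def sum.cartesian_product split_def)

lemma card_dendrimer_level_Suc:
  "card (dendrimer_level k (Suc j)) = card (dendrimer_level k j) * child_count k j"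
  unfolding card_eq_sum sum_dendrimer_level_Suc by simp

lemma card_dendrimer_level: "card (dendrimer_level k (Suc j)) = k * (k - 1) ^ j"
  by (induction j) (simp_all add: card_dendrimer_level_Suc dendrimer_level_0 child_count_def)

text \<open>Induction in steps of two: from \<open>l\<close> to \<open>l + 2\<close> just level
  \<open>l + 1\<close> is added, and with \<open>q = k - 1\<close> one has
  \<open>(q - 1) (q + 1) q^l = q^(l + 2) - q^l\<close>. The factor \<open>k - 2\<close> avoids
  dividing in the geometric sum.\<close>

lemma card_alternate_levels:
  assumes "k \<ge> 1"
  shows "(real k - 2) * card {xs \<in> dendrimer_verts l k. length xs < l \<and> odd (length xs + l)} =
     (real k - 1) ^ l - 1"
proof (induction l rule: induct_nat_012)
  case 1
  have "{xs \<in> dendrimer_verts (Suc 0) k. length xs < Suc 0 \<and> odd (length xs + Suc 0)} = {[]}"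
    by (auto simp: dendrimer_verts_def)
  then show ?case by simp
next
  case (ge2 l)
  let ?S = "\<lambda>l. {xs \<in> dendrimer_verts l k. length xs < l \<and> odd (length xs + l)}"
  have "?S (Suc (Suc l)) = ?S l \<union> dendrimer_level k (Suc l)"
    by (auto simp: dendrimer_level_def dendrimer_verts_def less_Suc_eq)
  moreover have "?S l \<inter> dendrimer_level k (Suc l) = {}"
    by (auto simp: dendrimer_level_def)
  ultimately have "card (?S (Suc (Suc l))) = card (?S l) + k * (k - 1) ^ l"
    by (simp add: card_Un_disjoint finite_dendrimer_verts card_dendrimer_level)
  then have "(real k - 2) * card (?S (Suc (Suc l))) =
      (real k - 1) ^ l - 1 + (real k - 2) * (real k * (real k - 1) ^ l)"
    using ge2 assms by (simp add: ring_distribs of_nat_diff)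
  then show ?case by (simp add: algebra_simps)
qed simp

section \<open>The two energy bounds specialized to dendrimers\<close>

lemma dendrimer_energy_upper:
  assumes "k \<ge> 2"
  shows "(real k - 2) * graph_energy (dendrimer l k) \<le> 2 * sqrt k * ((real k - 1) ^ l - 1)"
proof -
  let ?X = "{xs \<in> dendrimer_verts l k. length xs < l \<and> odd (length xs + l)}"
  have "graph_energy (dendrimer l k) \<le> 2 * (\<Sum>c\<in>?X. sqrt (real (out_degree (dendrimer l k) c)))"
  proof (rule graph_energy_le_sum_sqrt_degree[OF pair_graph_dendrimer])
    fix u v assume "(u, v) \<in> parcs (dendrimer l k)"
    then have uv: "u \<in> dendrimer_verts l k" "v \<in> dendrimer_verts l k"
      "length v = Suc (length u) \<or> length u = Suc (length v)"
      by (auto simp: dendrimer_def)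
    \<comment> \<open>For a leaf \<open>length x + l\<close> is even, so parity alone excludes the
      leaves.\<close>
    have "x \<in> ?X \<longleftrightarrow> odd (length x + l)" if "x \<in> dendrimer_verts l k" for x
      using that by (cases "length x = l") (auto simp: dendrimer_verts_def)
    then show "u \<in> ?X \<longleftrightarrow> v \<notin> ?X" using uv by auto
  qed (auto simp: dendrimer_def)
  also have "\<dots> = 2 * sqrt k * card ?X"
    using assms by (simp add: dendrimer_degree_internal)
  finally have "(real k - 2) * graph_energy (dendrimer l k) \<le> (real k - 2) * (2 * sqrt k * card ?X)"
    using assms by (intro mult_left_mono) auto
  also have "\<dots> = 2 * sqrt k * ((real k - 2) * card ?X)" by simp
  finally show ?thesis using card_alternate_levels[of k l] assms by simp
qed

text \<open>Let \<open>B\<close> be the biadjacency matrix between the \<open>m\<close> children of a vertex and their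
  neighbours, where each child has \<open>q\<close> children itself. Then \<open>B B\<^sup>T = q I + J\<close> with \<open>J\<close> the
  all-ones matrix, and the polar factor of \<open>B\<close> is
  \<open>(q I + J)\<^sup>-\<^sup>1\<^sup>/\<^sup>2 B = q\<^sup>-\<^sup>1\<^sup>/\<^sup>2 (I - \<alpha> J) B\<close>. The coefficient of the root in each row of it is \<open>\<beta>\<close>;
  below, \<open>x\<close> is the value at the root and \<open>\<surd>q h i\<close> the sum over the children of child \<open>i\<close>.\<close>

lemma star_polar_contraction:
  fixes x q :: real and m :: nat and h :: "nat \<Rightarrow> real"
  assumes m: "m > 0" and q: "q > 0"
  defines "\<beta> \<equiv> 1 / sqrt (q + m)"
  defines "\<alpha> \<equiv> (1 - sqrt q * \<beta>) / m"
  shows "(\<Sum>i<m. (\<beta> * x + (h i - \<alpha> * (\<Sum>i<m. h i)))\<^sup>2) \<le> x\<^sup>2 + (\<Sum>i<m. (h i)\<^sup>2)"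
proof -
  define H where "H = (\<Sum>i<m. h i)"
  \<comment> \<open>\<open>z\<close> is the shift common to all children; \<open>x\<close> interacts
    only with the all-ones component of \<open>h\<close>. The choice of \<open>\<alpha>\<close>
    makes \<open>I - \<alpha> J\<close> scale that component by
    \<open>sqrt q * \<beta>\<close>.\<close>
  define z where "z = \<beta> * x - \<alpha> * H"
  have b2: "\<beta>\<^sup>2 * (q + m) = 1" using m q by (simp add: \<beta>_def power_divide)
  have ma: "m * \<alpha> = 1 - sqrt q * \<beta>" using m by (simp add: \<alpha>_def)
  have "m * z + H = \<beta> * (m * x) - (m * \<alpha>) * H + H"
    by (simp add: z_def algebra_simps)
  then have zH: "m * z + H = \<beta> * (m * x + sqrt q * H)"
    unfolding ma by (simp add: algebra_simps)
  \<comment> \<open>Lagrange's identity, i.e. Cauchy-Schwarz with its defect, for the vectors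
    \<open>(sqrt m, sqrt q)\<close> and \<open>(sqrt m * x, H)\<close>.\<close>
  have "(q + m) * (m * x\<^sup>2 + H\<^sup>2) - (m * x + sqrt q * H)\<^sup>2 = m * (sqrt q * x - H)\<^sup>2"
    using q by (simp add: power2_eq_square algebra_simps)
  then have "(m * x + sqrt q * H)\<^sup>2 \<le> (q + m) * (m * x\<^sup>2 + H\<^sup>2)"
    using m by (smt (verit) mult_nonneg_nonneg of_nat_0_le_iff zero_le_power2)
  then have "\<beta>\<^sup>2 * (m * x + sqrt q * H)\<^sup>2 \<le> \<beta>\<^sup>2 * ((q + m) * (m * x\<^sup>2 + H\<^sup>2))"
    by (rule mult_left_mono) simp
  then have "(m * z + H)\<^sup>2 \<le> m * x\<^sup>2 + H\<^sup>2"
    unfolding zH power_mult_distrib mult.assoc[symmetric] b2 by simp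
  then have "m * (m * z\<^sup>2 + 2 * z * H) \<le> m * x\<^sup>2"
    by (simp add: power2_eq_square algebra_simps)
  then have le: "m * z\<^sup>2 + 2 * z * H \<le> x\<^sup>2" using m by simp
  have "(\<Sum>i<m. (\<beta> * x + (h i - \<alpha> * H))\<^sup>2) = (\<Sum>i<m. z\<^sup>2 + 2 * z * h i + (h i)\<^sup>2)"
    by (intro sum.cong) (auto simp: z_def power2_eq_square algebra_simps)
  also have "\<dots> = m * z\<^sup>2 + 2 * z * H + (\<Sum>i<m. (h i)\<^sup>2)"
    by (simp add: sum.distrib H_def sum_distrib_left)
  finally show ?thesis using le by (simp add: H_def)
qed

text \<open>The subtrees rooted at level \<open>p\<close> are disjoint, so their polar factors
  together form a contraction from levels \<open>p\<close> and \<open>p + 2\<close> to level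
  \<open>p + 1\<close>. Each of the \<open>k q^p\<close> vertices of level \<open>p + 1\<close>
  contributes the same amount to the pairing.\<close>

lemma dendrimer_energy_lower:
  fixes k p :: nat
  assumes k: "k \<ge> 2"
  defines "q \<equiv> real k - 1" and "m \<equiv> child_count k p"
  defines "\<beta> \<equiv> 1 / sqrt (q + m)"
  defines "\<alpha> \<equiv> (1 - sqrt q * \<beta>) / m"
  shows "2 * (real k * q ^ p) * (\<beta> + sqrt q * (1 - \<alpha>)) \<le> graph_energy (dendrimer (Suc (Suc p)) k)"
proof -
  let ?G = "dendrimer (Suc (Suc p)) k"
  let ?R = "dendrimer_level k p" and ?C = "dendrimer_level k (Suc p)"
  let ?L = "dendrimer_level k (Suc (Suc p))"
  have q0: "q > 0" and m0: "m > 0" using k by (auto simp: q_def m_def child_count_def)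
  have cc: "child_count k (Suc p) = k - 1" by (simp add: child_count_def)
  have rq: "real (k - 1) = q" using k by (simp add: q_def of_nat_diff)
  \<comment> \<open>Columns at level \<open>p\<close> hold the root coefficient
    \<open>\<beta>\<close>; columns at level \<open>p + 2\<close> hold the entry of
    \<open>q^(-1/2) (I - \<alpha> J)\<close> at \<open>c\<close> and the parent of \<open>v\<close>.
    The grandparent test confines \<open>J\<close> to one subtree.\<close>
  define W :: "nat list \<Rightarrow> nat list \<Rightarrow> real" where "W c v =
    (if length v = p then \<beta> * of_bool (v = butlast c)
     else (of_bool (butlast v = c) - \<alpha> * of_bool (butlast (butlast v) = butlast c)) / sqrt q)" for c v
  define h where "h f r i = (\<Sum>d<k - 1. f (r @ [i, d]) / sqrt q)" for f :: "nat list \<Rightarrow> real" and r i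
  have sumY: "(\<Sum>v\<in>?R \<union> ?L. g v) = (\<Sum>v\<in>?R. g v) + (\<Sum>r\<in>?R. \<Sum>i<m. \<Sum>d<k - 1. g (r @ [i, d]))"
    for g :: "nat list \<Rightarrow> real"
  proof -
    have "?R \<inter> ?L = {}" by (auto simp: dendrimer_level_def)
    then show ?thesis
      by (simp add: sum.union_disjoint sum_dendrimer_level_Suc cc m_def)
  qed
  have row: "(\<Sum>v\<in>?R \<union> ?L. W (r @ [i]) v * f v) = \<beta> * f r + (h f r i - \<alpha> * (\<Sum>i<m. h f r i))"
    if r: "r \<in> ?R" and i: "i < m" for r i f
  proof -
    have len: "length r' = p" if "r' \<in> ?R" for r' using that by (rule length_dendrimer_level)
    have "(\<Sum>v\<in>?R. W (r @ [i]) v * f v) = (\<Sum>v\<in>?R. if v = r then \<beta> * f r else 0)"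
      by (intro sum.cong) (auto simp: W_def len)
    then have 1: "(\<Sum>v\<in>?R. W (r @ [i]) v * f v) = \<beta> * f r" using r by simp
    have "(\<Sum>i'<m. \<Sum>d<k - 1. W (r @ [i]) (r' @ [i', d]) * f (r' @ [i', d])) =
        (if r' = r then h f r i - \<alpha> * (\<Sum>i<m. h f r i) else 0)" if r': "r' \<in> ?R" for r'
    proof -
      have W: "W (r @ [i]) (r' @ [i', d]) = of_bool (r' = r) * (of_bool (i' = i) - \<alpha>) / sqrt q" for i' d
        by (auto simp: W_def len[OF r'] butlast_append)
      have "(\<Sum>i'<m. \<Sum>d<k - 1. W (r @ [i]) (r' @ [i', d]) * f (r' @ [i', d])) =
          (\<Sum>i'<m. of_bool (r' = r) * (of_bool (i' = i) - \<alpha>) * h f r' i')"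
        unfolding h_def sum_distrib_left W by (simp add: mult_ac)
      also have "\<dots> = of_bool (r' = r) * ((\<Sum>i'<m. of_bool (i' = i) * h f r' i') - \<alpha> * (\<Sum>i'<m. h f r' i'))"
        unfolding sum_distrib_left sum_subtractf[symmetric]
        by (intro sum.cong) (auto simp: algebra_simps)
      also have "(\<Sum>i'<m. of_bool (i' = i) * h f r' i') = (\<Sum>i'<m. if i' = i then h f r' i else 0)"
        by (intro sum.cong) auto
      finally show ?thesis using i by auto
    qed
    then have "(\<Sum>r'\<in>?R. \<Sum>i'<m. \<Sum>d<k - 1. W (r @ [i]) (r' @ [i', d]) * f (r' @ [i', d])) =
        (\<Sum>r'\<in>?R. if r' = r then h f r i - \<alpha> * (\<Sum>i<m. h f r i) else 0)"
      by (intro sum.cong) auto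
    with 1 r show ?thesis unfolding sumY by simp
  qed
  have V: "dendrimer_level k j \<subseteq> pverts ?G" if "j \<le> Suc (Suc p)" for j
    using dendrimer_level_eq[OF that, of k] by (auto simp: dendrimer_def)
  have "2 * (\<Sum>c\<in>?C. \<Sum>v\<in>?R \<union> ?L. W c v * adj ?G c v) \<le> graph_energy ?G"
  proof (rule graph_energy_ge_contraction[OF pair_graph_dendrimer])
    fix f :: "nat list \<Rightarrow> real"
    have "(\<Sum>c\<in>?C. (\<Sum>v\<in>?R \<union> ?L. W c v * f v)\<^sup>2) =
        (\<Sum>r\<in>?R. \<Sum>i<m. (\<beta> * f r + (h f r i - \<alpha> * (\<Sum>i<m. h f r i)))\<^sup>2)"
      unfolding sum_dendrimer_level_Suc m_def[symmetric]
      by (intro sum.cong refl arg_cong[of _ _ "\<lambda>x. x\<^sup>2"] row) auto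
    also have "\<dots> \<le> (\<Sum>r\<in>?R. (f r)\<^sup>2 + (\<Sum>i<m. (h f r i)\<^sup>2))"
      unfolding \<alpha>_def \<beta>_def by (intro sum_mono star_polar_contraction m0 q0)
    also have "\<dots> \<le> (\<Sum>r\<in>?R. (f r)\<^sup>2 + (\<Sum>i<m. \<Sum>d<k - 1. (f (r @ [i, d]))\<^sup>2))"
    proof (intro sum_mono add_left_mono)
      fix r i
      \<comment> \<open>Cauchy-Schwarz over \<open>q\<close> children; the \<open>1 / sqrt q\<close>
        in \<open>h\<close> compensates for their number.\<close>
      have "(h f r i)\<^sup>2 = (\<Sum>d<k - 1. f (r @ [i, d]))\<^sup>2 / q"
        using q0 by (simp add: h_def power_divide flip: sum_divide_distrib)
      also have "\<dots> \<le> (q * (\<Sum>d<k - 1. (f (r @ [i, d]))\<^sup>2)) / q"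
        using sum_squared_le_sum_of_squares[of "\<lambda>d. f (r @ [i, d])" "{..<k - 1}"] q0 rq
        by (intro divide_right_mono) (auto simp: mult.commute)
      finally show "(h f r i)\<^sup>2 \<le> (\<Sum>d<k - 1. (f (r @ [i, d]))\<^sup>2)" using q0 by simp
    qed
    also have "\<dots> = (\<Sum>v\<in>?R \<union> ?L. (f v)\<^sup>2)"
      unfolding sumY by (simp add: sum.distrib)
    finally show "(\<Sum>c\<in>?C. (\<Sum>v\<in>?R \<union> ?L. W c v * f v)\<^sup>2) \<le> (\<Sum>v\<in>?R \<union> ?L. (f v)\<^sup>2)" .
  qed (use V in \<open>auto simp: dendrimer_level_def\<close>)
  also have "(\<Sum>c\<in>?C. \<Sum>v\<in>?R \<union> ?L. W c v * adj ?G c v) = (\<Sum>c\<in>?C. \<beta> + sqrt q * (1 - \<alpha>))"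
    unfolding sum_dendrimer_level_Suc[of _ k p] m_def[symmetric]
  proof (intro sum.cong refl)
    fix r i assume r: "r \<in> ?R" and "i \<in> {..<m}"
    then have i: "i < m" by simp
    have c: "r @ [i] \<in> ?C" using r i by (auto simp: dendrimer_level_Suc m_def)
    have up: "adj ?G (r @ [i]) r = 1"
      using V[of p] V[of "Suc p"] r c by (auto simp: adj_def dendrimer_def)
    have "adj ?G (r @ [i]) (r @ [i', d]) = of_bool (i' = i)" if "i' < m" "d < k - 1" for i' d
    proof -
      have "r @ [i'] \<in> ?C" using r that by (auto simp: dendrimer_level_Suc m_def)
      then have "r @ [i', d] \<in> ?L"
        using that by (auto simp: dendrimer_level_Suc[of k "Suc p"] cc image_iff intro!: bexI[of _ "r @ [i']"])
      then show ?thesis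
        using V[of "Suc p"] V[of "Suc (Suc p)"] c by (auto simp: adj_def dendrimer_def)
    qed
    \<comment> \<open>The adjacency row of child \<open>i\<close> is 1 on the \<open>q\<close>
      children of \<open>i\<close> and 0 on those of its siblings, and
      \<open>q / sqrt q = sqrt q\<close>.\<close>
    then have h: "h (adj ?G (r @ [i])) r i' = of_bool (i' = i) * sqrt q" if "i' < m" for i'
      using that rq q0 by (simp add: h_def real_div_sqrt)
    have "(\<Sum>i'<m. h (adj ?G (r @ [i])) r i') = (\<Sum>i'<m. if i' = i then sqrt q else 0)"
      by (intro sum.cong) (auto simp: h)
    then have "(\<Sum>i'<m. h (adj ?G (r @ [i])) r i') = sqrt q" using i by simp
    then show "(\<Sum>v\<in>?R \<union> ?L. W (r @ [i]) v * adj ?G (r @ [i]) v) = \<beta> + sqrt q * (1 - \<alpha>)"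
      using i up by (simp add: row[OF r i] h algebra_simps)
  qed
  finally show ?thesis
    using rq by (simp add: card_dendrimer_level mult_ac)
qed

section \<open>Comparison with the stated closed forms\<close>

theorem theorem2:
  fixes k l :: nat
  assumes "k \<ge> 3" and "l \<ge> 2"
  shows "graph_energy (dendrimer l k) <
           (real k - 1) powr (real l - 1/2) *
           (2 + (1/2 + sqrt 2 + sqrt 3 + sqrt 5) / (real k - 1)) \<and>
         graph_energy (dendrimer l k) >
           (real k - 1) powr (real l - 1/2) * (2 + 2 * sqrt 2 / (real k - 1))"
proof -
  define q where "q = real k - 1"
  define p where "p = l - 2"
  define s where "s = sqrt q"
  have l: "l = Suc (Suc p)" using assms(2) by (simp add: p_def)
  have q: "q \<ge> 2" and k: "real k = q + 1" using assms(1) by (auto simp: q_def)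
  have s: "s > 0" "s * s = q" using q by (auto simp: s_def)
  have "q powr (real l - 1/2) = q powr (real (Suc p) + 1/2)" by (simp add: l)
  also have "\<dots> = q ^ Suc p * s"
    using q by (simp only: powr_add powr_realpow powr_half_sqrt s_def)
  finally have powr: "q powr (real l - 1/2) = q ^ Suc p * s" .
  let ?E = "graph_energy (dendrimer l k)"
  let ?S = "1/2 + sqrt 2 + sqrt 3 + sqrt 5 :: real"
  have "?E < q ^ Suc p * s * (2 + ?S / q)"
  proof -
    have "sqrt 2 \<ge> 141/100" "sqrt 3 \<ge> 173/100" "sqrt 5 \<ge> 223/100"
      by (rule real_le_rsqrt; simp add: power2_eq_square)+
    then have S: "?S \<ge> 587/100" by simp
    \<comment> \<open>The upper bound with common factors cleared. At \<open>q = 2\<close> the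
      estimate \<open>sqrt ((q + 1) * q) \<le> q + 1/2\<close> used for larger \<open>q\<close> is
      too coarse: it would require \<open>10 \<le> 4 + ?S\<close>, but \<open>?S < 5.9\<close>.
      There \<open>sqrt 6 \<le> 2.45\<close> is used instead.\<close>
    have key: "2 * (sqrt (q + 1) * (s * q)) \<le> (2 * q + ?S) * (q - 1)"
    proof (cases "q = 2")
      case True
      have "sqrt (q + 1) * s = sqrt 6" by (simp add: True s_def flip: real_sqrt_mult)
      also have "\<dots> \<le> 245/100" by (rule real_le_lsqrt) (auto simp: power2_eq_square)
      finally show ?thesis using True S by (simp add: mult.assoc[symmetric])
    next
      case False
      have "real k \<ge> 4"
      proof (rule ccontr)
        assume "\<not> real k \<ge> 4"
        then have "k = 3" using assms(1) by linarith
        with False k show False by simp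
      qed
      then have q3: "q \<ge> 3" by (simp add: k)
      have "sqrt (q + 1) * s = sqrt ((q + 1) * q)" by (simp add: s_def real_sqrt_mult)
      also have "\<dots> \<le> q + 1/2"
        using q by (intro real_le_lsqrt) (auto simp: power2_eq_square algebra_simps)
      finally have "2 * (sqrt (q + 1) * s) * q \<le> 2 * (q + 1/2) * q"
        using q by (intro mult_right_mono) auto
      also have "\<dots> \<le> (2 * q + 587/100) * (q - 1)"
        using q3 by (simp add: algebra_simps)
      also have "\<dots> \<le> (2 * q + ?S) * (q - 1)"
        using S q by (intro mult_right_mono) auto
      finally show ?thesis by (simp add: mult_ac)
    qed
    have "(q - 1) * ?E \<le> 2 * sqrt (q + 1) * (q ^ l - 1)"
      using dendrimer_energy_upper[of k l] assms(1) by (simp add: k)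
    \<comment> \<open>Discarding the \<open>- 1\<close> gives strictness.\<close>
    also have "\<dots> < 2 * sqrt (q + 1) * q ^ l"
      using q by (intro mult_strict_left_mono) auto
    also have "\<dots> = q ^ p * s * (2 * (sqrt (q + 1) * (s * q)))"
      using s by (simp add: l mult_ac)
    also have "\<dots> \<le> q ^ p * s * ((2 * q + ?S) * (q - 1))"
      using key q s by (intro mult_left_mono) auto
    also have "\<dots> = (q - 1) * (q ^ Suc p * s * (2 + ?S / q))"
      using q by (simp add: field_simps)
    finally show ?thesis using q by simp
  qed
  moreover have "q ^ Suc p * s * (2 + 2 * sqrt 2 / q) < ?E"
  proof (cases p)
    case 0
    \<comment> \<open>For \<open>l = 2\<close> the subtree is the whole dendrimer and its root has
      \<open>k = q + 1\<close> children, so \<open>q + m = 2 q + 1\<close>.\<close>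
    define t where "t = sqrt (q + k)"
    have t: "t > 0" "t * t = 2 * q + 1" using q by (auto simp: t_def k)
    have "q ^ Suc p * s * (2 + 2 * sqrt 2 / q) = 2 * (q * s) + 2 * (sqrt 2 * s)"
      using q 0 by (simp add: field_simps)
    \<comment> \<open>Strictness: \<open>2 q < 2 q + 1\<close> under the square root.\<close>
    also have "sqrt 2 * s < t"
      using q by (simp add: s_def t_def k flip: real_sqrt_mult)
    \<comment> \<open>The pairing is the sum of the singular values of the star: \<open>t\<close>
      once and \<open>s\<close> repeated \<open>q\<close> times.\<close>
    also have "2 * (q * s) + 2 * t = 2 * real k * (1 / t + s * (1 - (1 - s * (1 / t)) / k))"
    proof -
      have "real k * (1 / t + s * (1 - (1 - s * (1 / t)) / k)) =
          real k / t + s * (k - (1 - s / t))"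
      proof -
        have "real k * (a + s * (1 - c / k)) = real k * a + s * (k - c)" for a c :: real
          using assms(1) by (simp add: field_simps)
        from this[of "1 / t" "1 - s / t"] show ?thesis by simp
      qed
      also have "\<dots> = (k + s * s) / t + s * q"
        by (simp add: k algebra_simps add_divide_distrib)
      also have "(k + s * s) / t = t" using t s by (simp add: k field_simps)
      finally have "real k * (1 / t + s * (1 - (1 - s * (1 / t)) / k)) = t + s * q" .
      then show ?thesis unfolding mult.assoc by (simp only:) (simp add: algebra_simps)
    qed
    also have "\<dots> \<le> ?E"
      using dendrimer_energy_lower[of k p] assms(1) 0
      by (simp add: child_count_def t_def s_def l q_def)
    finally show ?thesis by simp
  next
    case (Suc p')
    \<comment> \<open>For \<open>l \<ge> 3\<close> the subtree roots have \<open>m = q\<close>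
      children, so \<open>q + m = 2 q\<close>.\<close>
    have cc: "real (child_count k p) = q" using Suc assms(1) by (simp add: child_count_def q_def of_nat_diff)
    have t: "sqrt (q + q) = sqrt 2 * s" by (simp add: s_def flip: real_sqrt_mult)
    have r2: "sqrt 2 * sqrt 2 = (2 :: real)" "sqrt 2 > (1 :: real)" by auto
    have "q * q * (2 + 2 * sqrt 2 / q) = 2 * q * q + 2 * sqrt 2 * q"
      using q by (simp add: field_simps)
    \<comment> \<open>The two sides differ by exactly \<open>2 * (sqrt 2 - 1)\<close>.\<close>
    also have "\<dots> < 2 * (q + 1) * (sqrt 2 + q - 1)"
      using r2 by (simp add: algebra_simps)
    finally have "q ^ p / s * (q * q * (2 + 2 * sqrt 2 / q)) < q ^ p / s * (2 * (q + 1) * (sqrt 2 + q - 1))"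
      using q s by (intro mult_strict_left_mono) auto
    moreover have "q ^ p / s * (q * q * (2 + 2 * sqrt 2 / q)) = q ^ Suc p * s * (2 + 2 * sqrt 2 / q)"
    proof -
      have "q / s = s" using s by (simp add: field_simps)
      have "q ^ p / s * (q * q * (2 + 2 * sqrt 2 / q)) = q ^ p * q * (q / s) * (2 + 2 * sqrt 2 / q)"
        by simp
      then show ?thesis unfolding \<open>q / s = s\<close> by simp
    qed
    moreover have "q ^ p / s * (2 * (q + 1) * (sqrt 2 + q - 1)) =
        2 * (real k * q ^ p) * (1 / (sqrt 2 * s) + s * (1 - (1 - s * (1 / (sqrt 2 * s))) / q))"
    proof -
      \<comment> \<open>The mean of the \<open>q\<close> singular values, \<open>sqrt 2 * s\<close>
        once and \<open>s\<close> repeated \<open>q - 1\<close> times, rewritten with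
        \<open>s * s = q\<close>.\<close>
      have "1 / (sqrt 2 * s) + s * (1 - (1 - s * (1 / (sqrt 2 * s))) / q) = (sqrt 2 + q - 1) / s"
      proof -
        have "1 / sqrt 2 = sqrt 2 / (2 :: real)" using r2 by (simp add: field_simps)
        then have i: "1 / (sqrt 2 * s) = sqrt 2 / 2 / s" by (metis divide_divide_eq_left)
        have "s * (1 - (1 - s * (sqrt 2 / 2 / s)) / q) = (q - 1 + sqrt 2 / 2) / s"
        proof -
          have "s * (1 - c / q) = s / q * (q - c)" for c
            using q by (simp add: field_simps)
          moreover have "s / q = 1 / s" using s q by (simp add: field_simps)
          moreover have "s * (sqrt 2 / 2 / s) = sqrt 2 / 2" using s by simp
          ultimately show ?thesis by simp
        qed
        then show ?thesis unfolding i by (simp add: add_divide_distrib diff_divide_distrib)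
      qed
      then show ?thesis by (simp add: k)
    qed
    moreover have "2 * (real k * q ^ p) * (1 / (sqrt 2 * s) + s * (1 - (1 - s * (1 / (sqrt 2 * s))) / q)) \<le> ?E"
      using dendrimer_energy_lower[of k p] assms(1) unfolding cc q_def[symmetric] t l
      by (simp add: s_def)
    ultimately show ?thesis by linarith
  qed
  ultimately show ?thesis unfolding q_def[symmetric] powr by simp
qed

end
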